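(* Let $n\ge 1$, let $a_1,\dots,a_n,b,m$ be integers with $m\neq 0$, and let $d=\gcd(a_1,\dots,a_n,m)$. If $d\mid b$, then the congruence $a_1x_1+\dots+a_nx_n\equiv b\pmod m$ has exactly $d\cdot|m|^{n-1}$ distinct solutions.
   Context: Solutions are counted modulo $m$: two integer solutions $(x_1,\dots,x_n)$ and $(x_1',\dots,x_n')$ are regarded as the same if $x_i\equiv x_i'\pmod m$ for all $i=1,\dots,n$, and as distinct otherwise. Thus the number of distinct solutions is the number of solutions in $(\mathbb{Z}/m\mathbb{Z})^n$. The gcd is taken to be positive. *)

theory Defs
  imports "HOL-Number_Theory.Cong" "HOL-Library.FuncSet"
begin

(* An integer n-tuple (x_1, ..., x_n) is an extensional function on {1..n}, so that
   distinct elements of the set are distinct tuples. *)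
definition lin_cong_solutions :: "nat \<Rightarrow> (nat \<Rightarrow> int) \<Rightarrow> int \<Rightarrow> int \<Rightarrow> (nat \<Rightarrow> int) set" where
  "lin_cong_solutions n a b m =
     {x \<in> {1..n} \<rightarrow>\<^sub>E UNIV. [(\<Sum>i=1..n. a i * x i) = b] (mod m)}"

definition same_solution :: "nat \<Rightarrow> (nat \<Rightarrow> int) \<Rightarrow> int \<Rightarrow> int \<Rightarrow> ((nat \<Rightarrow> int) \<times> (nat \<Rightarrow> int)) set" where
  "same_solution n a b m =
     {(x, x'). x \<in> lin_cong_solutions n a b m \<and> x' \<in> lin_cong_solutions n a b m \<and>
               (\<forall>i\<in>{1..n}. [x i = x' i] (mod m))}"

lemma equiv_same_solution: "equiv (lin_cong_solutions n a b m) (same_solution n a b m)"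
proof (rule equivI)
  show "same_solution n a b m \<subseteq> lin_cong_solutions n a b m \<times> lin_cong_solutions n a b m"
    by (auto simp: same_solution_def)
  show "refl_on (lin_cong_solutions n a b m) (same_solution n a b m)"
    by (auto simp: refl_on_def same_solution_def)
  show "sym (same_solution n a b m)"
    by (auto simp: sym_def same_solution_def cong_sym_eq)
  show "trans (same_solution n a b m)"
    unfolding trans_def same_solution_def by (auto intro: cong_trans)
qed

definition num_distinct_solutions :: "nat \<Rightarrow> (nat \<Rightarrow> int) \<Rightarrow> int \<Rightarrow> int \<Rightarrow> nat" where
  "num_distinct_solutions n a b m = card (lin_cong_solutions n a b m // same_solution n a b m)"

end

(* Each residue class of solutions has a unique representative with entries in {0..<|m|}.
   Splitting off one variable t turns the congruence into one with right-hand side b - a t, which by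
   induction is solvable iff the gcd e of the remaining coefficients and m divides b - a t.  Since
   e divides m, this happens for m gcd(a, e) / e residues t modulo m. *)

theory Submission
  imports Defs
begin

text \<open>The interval consists of \<open>k\<close> blocks of length \<open>q\<close>, and each
  block meets the residue class of \<open>c\<close> exactly once, at \<open>c mod q + q * j\<close>.
  The case \<open>k = 0\<close> is the empty interval.\<close>

lemma card_cong_range:
  fixes q k c :: int
  assumes "q > 0" "k \<ge> 0"
  shows "int (card {x \<in> {0..<q * k}. q dvd x - c}) = k"
proof -
  have "{x \<in> {0..<q * k}. q dvd x - c} = (\<lambda>j. c mod q + q * j) ` {0..<k}"
  proof (intro equalityI subsetI)
    fix x assume x: "x \<in> {x \<in> {0..<q * k}. q dvd x - c}"
    then have "c mod q = x mod q"
      using mod_eq_dvd_iff by (metis (no_types, lifting) mem_Collect_eq)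
    then have "x = c mod q + q * (x div q)"
      by simp
    moreover have "x div q \<in> {0..<k}"
    proof -
      have "q * (x div q) \<le> x"
        using \<open>q > 0\<close> by (metis add_increasing2 mult_div_mod_eq order_refl pos_mod_sign)
      also have "x < q * k"
        using x by simp
      finally have "x div q < k"
        using \<open>q > 0\<close> by simp
      then show ?thesis
        using x \<open>q > 0\<close> by (simp add: pos_imp_zdiv_nonneg_iff)
    qed
    ultimately show "x \<in> (\<lambda>j. c mod q + q * j) ` {0..<k}"
      by blast
  next
    fix x assume "x \<in> (\<lambda>j. c mod q + q * j) ` {0..<k}"
    then obtain j where j: "0 \<le> j" "j + 1 \<le> k" "x = c mod q + q * j"
      by auto
    \<comment> \<open>Writing \<open>j < k\<close> as \<open>j + 1 \<le> k\<close> leaves a whole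
      block of length \<open>q\<close> for the remainder \<open>c mod q\<close>.\<close>
    have "q * (j + 1) \<le> q * k"
      using j \<open>q > 0\<close> by (intro mult_left_mono) auto
    moreover have "0 \<le> c mod q" "c mod q < q"
      using \<open>q > 0\<close> by auto
    ultimately have "x < q * k"
      using j by (simp add: algebra_simps)
    moreover have "0 \<le> x"
      using j \<open>q > 0\<close> by simp
    moreover have "q dvd x - c"
      using j(3) by (simp add: mod_eq_dvd_iff[symmetric])
    ultimately show "x \<in> {x \<in> {0..<q * k}. q dvd x - c}"
      by simp
  qed
  moreover have "inj_on (\<lambda>j. c mod q + q * j) {0..<k}"
    using \<open>q > 0\<close> by (auto intro: inj_onI)
  ultimately show ?thesis
    using \<open>k \<ge> 0\<close> by (simp add: card_image)
qed

text \<open>Dividing by \<open>g = gcd a e\<close> makes the coefficient invertible modulo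
  \<open>q = e / g\<close>, so the solutions form one residue class modulo \<open>q\<close>, which
  has \<open>m / q = m * g / e\<close> members below \<open>m\<close>. The factor \<open>e\<close>
  on the left avoids this division.\<close>

lemma card_lin_cong_one_variable:
  fixes a b e m :: int
  assumes "m > 0" "e > 0" "e dvd m"
  shows "e * int (card {x \<in> {0..<m}. e dvd b - a * x}) = (if gcd a e dvd b then m * gcd a e else 0)"
proof (cases "gcd a e dvd b")
  case False
  have "\<not> e dvd b - a * x" for x
  proof
    assume "e dvd b - a * x"
    then have "gcd a e dvd (b - a * x) + a * x"
      by (intro dvd_add) (auto intro: dvd_trans)
    with False show False by simp
  qed
  with False show ?thesis by simp
next
  case True
  define g where "g = gcd a e"
  have g: "g > 0"
    using \<open>e > 0\<close> by (simp add: g_def)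
  obtain a' q where a': "a = g * a'" and q: "e = g * q" and cop: "coprime a' q"
    using gcd_coprime_exists[of a e] g unfolding g_def by (metis less_irrefl mult.commute)
  obtain b' where b': "b = g * b'"
    using True by (auto simp: g_def)
  have "q > 0"
    using q g \<open>e > 0\<close> by (simp add: zero_less_mult_iff)
  \<comment> \<open>Here \<open>k\<close> is \<open>m / e\<close>; the factors are grouped so that
    \<open>g * k\<close> counts the blocks of length \<open>q\<close> in
    \<open>{0..<m}\<close>.\<close>
  obtain k where k: "m = q * (g * k)"
    using \<open>e dvd m\<close> unfolding q by (metis dvdE mult.assoc mult.commute)
  have "g * k \<ge> 0"
    using k \<open>m > 0\<close> \<open>q > 0\<close> by (smt (verit) zero_less_mult_iff)
  \<comment> \<open>\<open>u\<close> inverts \<open>a'\<close> modulo \<open>q\<close>, so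
    \<open>u * b'\<close> represents the solution class.\<close>
  obtain u where "[a' * u = 1] (mod q)"
    using cong_solve_coprime_int[OF cop] by blast
  then have u: "[a' * (u * b') = b'] (mod q)"
    using cong_scalar_right[of "a' * u" 1 q b'] by (simp add: mult_ac)
  have "e dvd b - a * x \<longleftrightarrow> q dvd x - u * b'" for x
  proof -
    have "b - a * x = g * (b' - a' * x)"
      by (simp add: a' b' algebra_simps)
    then have "e dvd b - a * x \<longleftrightarrow> q dvd b' - a' * x"
      using g by (simp add: q)
    also have "\<dots> \<longleftrightarrow> [a' * x = b'] (mod q)"
      by (simp add: cong_iff_dvd_diff dvd_diff_commute)
    also have "\<dots> \<longleftrightarrow> [a' * x = a' * (u * b')] (mod q)"
      using u cong_sym cong_trans by blast
    also have "\<dots> \<longleftrightarrow> q dvd x - u * b'"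
      using cop by (simp add: cong_mult_lcancel cong_iff_dvd_diff[symmetric])
    finally show ?thesis .
  qed
  then have "int (card {x \<in> {0..<m}. e dvd b - a * x}) = g * k"
    using card_cong_range[OF \<open>q > 0\<close> \<open>g * k \<ge> 0\<close>] k by simp
  then have "e * int (card {x \<in> {0..<m}. e dvd b - a * x}) = e * (g * k)"
    by (rule arg_cong)
  also have "\<dots> = m * gcd a e"
    unfolding g_def[symmetric] k by (simp add: q)
  finally show ?thesis
    using True by simp
qed

text \<open>The factor \<open>m\<close> on the left replaces the exponent \<open>card I - 1\<close>
  by \<open>card I\<close>, so the induction can start at the empty set. The unsolvable case is
  included because the induction step meets right-hand sides of both sorts.\<close>

lemma card_reduced_solutions:
  fixes a :: "'i \<Rightarrow> int" and b m :: int
  assumes "finite I" "m > 0"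
  shows "m * int (card {x \<in> I \<rightarrow>\<^sub>E {0..<m}. m dvd b - (\<Sum>i\<in>I. a i * x i)}) =
         (if Gcd (insert m (a ` I)) dvd b then Gcd (insert m (a ` I)) * m ^ card I else 0)"
  using \<open>finite I\<close>
proof (induction I arbitrary: b rule: finite_induct)
  case empty
  \<comment> \<open>The only tuple is the empty one, and it counts exactly if
    \<open>m dvd b\<close>; the gcd is then \<open>m\<close> itself.\<close>
  then show ?case
    using \<open>m > 0\<close> by (auto simp: Collect_conv_if)
next
  case (insert j I)
  define e where "e = Gcd (insert m (a ` I))"
  define R where "R b = {x \<in> I \<rightarrow>\<^sub>E {0..<m}. m dvd b - (\<Sum>i\<in>I. a i * x i)}" for b
  define T where "T = {t \<in> {0..<m}. e dvd b - a j * t}"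
  have "e dvd m"
    by (simp add: e_def)
  moreover have "e \<ge> 0"
    by (simp add: e_def)
  ultimately have "e > 0"
    using \<open>m > 0\<close> by (cases "e = 0") auto
  have finR: "finite (R b)" for b
    unfolding R_def by (rule finite_subset[OF _ finite_PiE[of I "\<lambda>_. {0..<m}"]])
      (use insert.hyps in auto)
  have split_sum: "(\<Sum>i\<in>insert j I. a i * (x(j := t)) i) = a j * t + (\<Sum>i\<in>I. a i * x i)" for x t
  proof -
    have "(\<Sum>i\<in>I. a i * (x(j := t)) i) = (\<Sum>i\<in>I. a i * x i)"
      using insert.hyps by (intro sum.cong) auto
    then show ?thesis
      using insert.hyps by simp
  qed
  \<comment> \<open>A tuple on \<open>insert j I\<close> is its value \<open>t\<close> at
    \<open>j\<close> together with a tuple on \<open>I\<close>, which must solve the congruence with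
    \<open>a j * t\<close> moved to the right-hand side.\<close>
  have "{x \<in> insert j I \<rightarrow>\<^sub>E {0..<m}. m dvd b - (\<Sum>i\<in>insert j I. a i * x i)}
      = (\<lambda>(t, x). x(j := t)) ` (SIGMA t:{0..<m}. R (b - a j * t))"
    unfolding PiE_insert_eq R_def using split_sum by (auto simp: algebra_simps image_iff)
  moreover have "inj_on (\<lambda>(t, x). x(j := t)) (SIGMA t:{0..<m}. R (b - a j * t))"
    by (rule inj_on_subset[OF inj_combinator[of j I "\<lambda>_. {0..<m}"]])
      (use insert.hyps in \<open>auto simp: R_def\<close>)
  ultimately have "card {x \<in> insert j I \<rightarrow>\<^sub>E {0..<m}. m dvd b - (\<Sum>i\<in>insert j I. a i * x i)}
      = (\<Sum>t\<in>{0..<m}. card (R (b - a j * t)))"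
    using finR by (simp add: card_image)
  then have "m * int (card {x \<in> insert j I \<rightarrow>\<^sub>E {0..<m}. m dvd b - (\<Sum>i\<in>insert j I. a i * x i)})
      = (\<Sum>t\<in>{0..<m}. m * int (card (R (b - a j * t))))"
    by (simp add: sum_distrib_left)
  also have "\<dots> = (\<Sum>t\<in>{0..<m}. if e dvd b - a j * t then e * m ^ card I else 0)"
    unfolding R_def e_def by (intro sum.cong refl insert.IH)
  also have "\<dots> = (\<Sum>t\<in>T. e * m ^ card I)"
    unfolding T_def by (rule sum.inter_filter[symmetric]) simp
  also have "\<dots> = (e * int (card T)) * m ^ card I"
    by simp
  \<comment> \<open>The factor \<open>e\<close> from the induction hypothesis is just the one that
    the one-variable count requires; it is traded for the new gcd and one more factor
    \<open>m\<close>.\<close>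
  also have "\<dots> = (if gcd (a j) e dvd b then m * gcd (a j) e else 0) * m ^ card I"
    unfolding T_def card_lin_cong_one_variable[OF \<open>m > 0\<close> \<open>e > 0\<close> \<open>e dvd m\<close>] ..
  also have "gcd (a j) e = Gcd (insert m (a ` insert j I))"
    by (simp add: e_def insert_commute[of m] del: Gcd_insert) (simp add: e_def)
  finally show ?case
    using insert.hyps by (simp add: mult_ac)
qed

text \<open>Sending a reduced tuple to its class is a bijection: congruent entries in
  \<open>{0..<\<bar>m\<bar>}\<close> are equal, and every solution can be reduced entrywise.\<close>

lemma num_distinct_solutions_eq_card_reduced:
  assumes "m \<noteq> 0"
  shows "num_distinct_solutions n a b m =
         card {x \<in> {1..n} \<rightarrow>\<^sub>E {0..<\<bar>m\<bar>}. \<bar>m\<bar> dvd b - (\<Sum>i\<in>{1..n}. a i * x i)}"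
proof -
  let ?R = "{x \<in> {1..n} \<rightarrow>\<^sub>E {0..<\<bar>m\<bar>}. \<bar>m\<bar> dvd b - (\<Sum>i\<in>{1..n}. a i * x i)}"
  let ?S = "lin_cong_solutions n a b m" and ?r = "same_solution n a b m"
  have dvd_iff: "\<bar>m\<bar> dvd b - s \<longleftrightarrow> [s = b] (mod m)" for s
    by (simp add: cong_iff_dvd_diff dvd_diff_commute)
  have R_subset: "?R \<subseteq> ?S"
    unfolding lin_cong_solutions_def dvd_iff by auto
  have "bij_betw (\<lambda>x. ?r `` {x}) ?R (?S // ?r)"
    unfolding bij_betw_def
  proof (intro conjI inj_onI equalityI subsetI)
    fix x y assume x: "x \<in> ?R" and y: "y \<in> ?R" and "?r `` {x} = ?r `` {y}"
    then have "(x, y) \<in> ?r"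
      using eq_equiv_class[OF _ equiv_same_solution] R_subset by blast
    then have *: "[x i = y i] (mod \<bar>m\<bar>)" if "i \<in> {1..n}" for i
      using that by (auto simp: same_solution_def cong_iff_dvd_diff)
    show "x = y"
    proof (rule PiE_ext[where s = "\<lambda>_. {0..<\<bar>m\<bar>}"])
      fix i assume i: "i \<in> {1..n}"
      have "x i \<in> {0..<\<bar>m\<bar>}" "y i \<in> {0..<\<bar>m\<bar>}"
        using x y i by (auto dest: PiE_mem)
      with *[OF i] show "x i = y i"
        by (auto intro: cong_less_imp_eq_int)
    qed (use x y in auto)
  next
    fix X assume "X \<in> (\<lambda>x. ?r `` {x}) ` ?R"
    then show "X \<in> ?S // ?r"
      using R_subset by (auto intro: quotientI)
  next
    fix X assume "X \<in> ?S // ?r"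
    then obtain x where x: "x \<in> ?S" "X = ?r `` {x}"
      by (auto elim: quotientE)
    \<comment> \<open>Reduction is modulo \<open>\<bar>m\<bar>\<close> since remainders modulo a
      negative \<open>m\<close> are not positive; the restricted abstraction keeps \<open>y\<close>
      extensional.\<close>
    define y where "y = (\<lambda>i\<in>{1..n}. x i mod \<bar>m\<bar>)"
    have xy: "[x i = y i] (mod m)" if "i \<in> {1..n}" for i
    proof -
      have "\<bar>m\<bar> dvd x i - x i mod \<bar>m\<bar>"
        by (rule dvd_minus_mod)
      then have "m dvd x i - x i mod \<bar>m\<bar>"
        unfolding abs_dvd_iff .
      with that show ?thesis
        by (simp add: y_def cong_iff_dvd_diff)
    qed
    then have "[(\<Sum>i\<in>{1..n}. a i * x i) = (\<Sum>i\<in>{1..n}. a i * y i)] (mod m)"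
      by (intro cong_sum cong_scalar_left)
    then have "[(\<Sum>i\<in>{1..n}. a i * y i) = b] (mod m)"
      using x(1) unfolding lin_cong_solutions_def by (auto intro: cong_trans cong_sym)
    moreover have "y \<in> {1..n} \<rightarrow>\<^sub>E {0..<\<bar>m\<bar>}"
      using \<open>m \<noteq> 0\<close> by (auto simp: y_def)
    ultimately have y: "y \<in> ?R"
      unfolding dvd_iff by blast
    then have "(x, y) \<in> ?r"
      using x(1) R_subset xy unfolding same_solution_def by blast
    then have "X = ?r `` {y}"
      using x(2) equiv_class_eq[OF equiv_same_solution] by blast
    with y show "X \<in> (\<lambda>x. ?r `` {x}) ` ?R"
      by blast
  qed
  then show ?thesis
    unfolding num_distinct_solutions_def by (simp add: bij_betw_same_card)
qed

theorem theorem3: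
  fixes n :: nat and a :: "nat \<Rightarrow> int" and b m d :: int
  assumes "n \<ge> 1"
    and "m \<noteq> 0"
    and "d = Gcd (insert m (a ` {1..n}))"
    and "d dvd b"
  shows "int (num_distinct_solutions n a b m) = d * \<bar>m\<bar> ^ (n - 1)"
proof -
  have "d = Gcd (insert \<bar>m\<bar> (a ` {1..n}))"
    using assms(3) by simp
  then have "\<bar>m\<bar> * int (num_distinct_solutions n a b m) = d * \<bar>m\<bar> ^ n"
    using card_reduced_solutions[of "{1..n}" "\<bar>m\<bar>" b a] assms(2,4)
    by (simp add: num_distinct_solutions_eq_card_reduced)
  \<comment> \<open>As \<open>n \<ge> 1\<close>, the subtraction \<open>n - 1\<close> is not
    truncated, and one nonzero factor \<open>\<bar>m\<bar>\<close> splits off to be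
    cancelled.\<close>
  also have "\<dots> = \<bar>m\<bar> * (d * \<bar>m\<bar> ^ (n - 1))"
    using assms(1) by (simp add: power_eq_if)
  finally show ?thesis
    using assms(2) by simp
qed

end
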